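(* Let $W:\mathbb{R}^2\to[0,\infty)$ be a $C^3$ function vanishing precisely at two distinct points $\mathbf{p}_+,\mathbf{p}_-$. Assume that in neighborhoods $B_{\rho_\pm}(\mathbf{p}_\pm)$ of the wells, in local (orthonormal) coordinates $p=(p_1,p_2)$ centered at $\mathbf{p}_\pm$, $$W(p)=\lambda_{1,\pm}^2p_1^2+\lambda_{2,\pm}^2p_2^2+G(p),\qquad \lambda_{1,\pm},\lambda_{2,\pm}>0,$$ where $\nabla_pG(p)=g(p)$ with $|g(p)|\le C|p|^q$ and $q\ge3$ (the function $G$ may be different at the two wells). If $$\nu^2>\min\{2(\lambda_{1,+}+\lambda_{2,+})^2,\ 2(\lambda_{1,-}+\lambda_{2,-})^2\},$$ then there is no heteroclinic traveling wave with finite energy $H(U)<\infty$ and speed $\nu$.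
   Context: A heteroclinic traveling wave with speed $\nu\in\mathbb{R}$ is a solution $U:\mathbb{R}\to\mathbb{R}^2$ of $$-\nu\,\mathbb{J}U'=U''-\nabla_uW(U)\ \text{ on }(-\infty,\infty),\qquad \lim_{x\to\pm\infty}U(x)=\mathbf{p}_\pm,\qquad \mathbb{J}=\begin{pmatrix}0&1\\-1&0\end{pmatrix}.$$ The energy is $H(U)=\int_{-\infty}^\infty\frac12|U'|^2+W(U)\,dy$. *)

theory Defs
  imports "HOL-Analysis.Analysis"
begin

text \<open>On a finite-dimensional domain, continuity of all iterated directional derivatives up to
  order \<open>k\<close> is the usual notion of a \<open>C\<^sup>k\<close> function.\<close>

primrec Ck :: "nat \<Rightarrow> ('a::euclidean_space \<Rightarrow> 'b::real_normed_vector) \<Rightarrow> bool" where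
  "Ck 0 f \<longleftrightarrow> continuous_on UNIV f"
| "Ck (Suc k) f \<longleftrightarrow>
     (\<forall>x. f differentiable (at x)) \<and> (\<forall>v. Ck k (\<lambda>x. frechet_derivative f (at x) v))"

definition gradient :: "('a::real_inner \<Rightarrow> real) \<Rightarrow> 'a \<Rightarrow> 'a" where
  "gradient f x = (THE D. GDERIV f x :> D)"

definition J :: "real^2^2" where
  "J = vector [vector [0, 1], vector [-1, 0]]"

definition heteroclinic_wave ::
  "(real^2 \<Rightarrow> real) \<Rightarrow> real \<Rightarrow> real^2 \<Rightarrow> real^2 \<Rightarrow> (real \<Rightarrow> real^2) \<Rightarrow> bool" where
  "heteroclinic_wave W \<nu> p_plus p_minus U \<longleftrightarrow>
     (let U' = (\<lambda>x. vector_derivative U (at x));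
          U'' = (\<lambda>x. vector_derivative U' (at x))
      in (\<forall>x. U differentiable (at x)) \<and> (\<forall>x. U' differentiable (at x)) \<and>
         (\<forall>x. (- \<nu>) *\<^sub>R (J *v U' x) = U'' x - gradient W (U x)) \<and>
         (U \<longlongrightarrow> p_plus) at_top \<and> (U \<longlongrightarrow> p_minus) at_bot)"

definition energy :: "(real^2 \<Rightarrow> real) \<Rightarrow> (real \<Rightarrow> real^2) \<Rightarrow> ennreal" where
  "energy W U =
     (\<integral>\<^sup>+ y. ennreal (1 / 2 * (norm (vector_derivative U (at y)))\<^sup>2 + W (U y)) \<partial>lborel)"

text \<open>The map \<open>p \<mapsto> P + R p\<close>, with \<open>R\<close> orthogonal, passes from local orthonormal coordinates
  centered at \<open>P\<close> to points of the plane. The exponent \<open>q\<close> is real; \<open>0 powr q = 0\<close>, so the bound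
  on \<open>g\<close> includes \<open>g 0 = 0\<close>.\<close>

definition quadratic_well ::
  "(real^2 \<Rightarrow> real) \<Rightarrow> real^2 \<Rightarrow> real \<Rightarrow> real \<Rightarrow> real \<Rightarrow> real \<Rightarrow> real \<Rightarrow> bool" where
  "quadratic_well W P \<rho> l1 l2 C q \<longleftrightarrow>
     (\<exists>(R :: real^2 \<Rightarrow> real^2) (G :: real^2 \<Rightarrow> real) (g :: real^2 \<Rightarrow> real^2).
        orthogonal_transformation R \<and>
        (\<forall>p \<in> ball 0 \<rho>.
           W (P + R p) = l1\<^sup>2 * (p $ 1)\<^sup>2 + l2\<^sup>2 * (p $ 2)\<^sup>2 + G p \<and>
           (GDERIV G p :> g p) \<and>
           norm (g p) \<le> C * norm p powr q))"

end

theory Submission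
  imports Defs
begin

text \<open>
  Only one well matters. The reflection \<open>x \<mapsto> - x\<close> turns a wave of speed \<open>\<nu>\<close> into a wave of speed
  \<open>- \<nu>\<close> with the two ends exchanged and the same energy, so the well \<open>P\<close> at which
  \<open>\<nu>\<^sup>2 > 2 * (l1 + l2)\<^sup>2\<close> may be assumed to be the limit at \<open>+\<infinity>\<close>.

  In the orthonormal coordinates \<open>p = (u, v)\<close> of that well the equation reads, up to the cubic
  remainder \<open>g\<close> and with \<open>a = 2 * l1\<^sup>2\<close>, \<open>b = 2 * l2\<^sup>2\<close>,
  \<open>u'' = a * u - \<nu> * v'\<close> and \<open>v'' = b * v + \<nu> * u'\<close>.
  (An orientation reversing change of coordinates replaces \<open>\<nu>\<close> by \<open>- \<nu>\<close>, which is harmless.)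
  The rates \<open>\<mu>\<close> of its exponential solutions satisfy
  \<open>\<mu>\<^sup>4 + (\<nu>\<^sup>2 - a - b) * \<mu>\<^sup>2 + a * b = 0\<close>, and the hypothesis on \<open>\<nu>\<close> says exactly that this quadratic
  in \<open>\<mu>\<^sup>2\<close> has two distinct negative roots: all modes oscillate, and the linear flow has no stable
  directions at all. Accordingly it conserves a positive definite quadratic form of \<open>(p, p')\<close>,
  namely \<open>normal_mode_form\<close> (\<open>normal_mode_form_coercive\<close>).

  Along a solution of the nonlinear equation this form, \<open>E\<close>, is no longer constant, but the cubic
  bound on \<open>g\<close> gives \<open>\<bar>E'\<bar> \<le> K * dist U P\<^sup>2 * E\<close> near the well (\<open>almost_conserved_quantity\<close>). By
  Gronwall's inequality \<open>E\<close> either vanishes identically or never. In the first case \<open>U\<close> is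
  constantly \<open>P\<close> and misses its other limit. In the second case finite energy makes \<open>dist U P\<^sup>2\<close>
  integrable near \<open>+\<infinity>\<close>, because \<open>W\<close> dominates it near the well; hence \<open>E\<close> stays above a positive
  constant. But the energy density dominates \<open>E\<close>, so the energy is infinite.
\<close>

section \<open>Plane geometry\<close>

lemma J_mult_component [simp]:
  "(J *v w) $ 1 = w $ 2" "(J *v w) $ 2 = - w $ 1"
  by (simp_all add: J_def matrix_vector_mult_def sum_2)

lemma norm_sq_2: "(norm (w :: real^2))\<^sup>2 = (w $ 1)\<^sup>2 + (w $ 2)\<^sup>2"
  by (simp add: norm_eq_sqrt_inner inner_vec_def sum_2 power2_eq_square)

lemma inner_2: "(v :: real^2) \<bullet> w = v $ 1 * w $ 1 + v $ 2 * w $ 2"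
  by (simp add: inner_vec_def sum_2)

text \<open>
  The sign is the determinant \<open>a * d - b * c\<close> of \<open>R\<close>, whose columns are \<open>(a, b)\<close> and \<open>(c, d)\<close>:
  a rotation of the plane commutes with the quarter turn \<open>J\<close> and a reflection anticommutes with it.
\<close>

lemma orthogonal_transformation_J:
  assumes R: "orthogonal_transformation R"
  obtains \<sigma> :: real where "\<sigma>\<^sup>2 = 1" "\<And>w. J *v R w = \<sigma> *\<^sub>R R (J *v w)"
proof -
  define e1 e2 where "e1 = (axis 1 1 :: real^2)" and "e2 = (axis 2 1 :: real^2)"
  have lin: "linear R" and ip: "\<And>v w. R v \<bullet> R w = v \<bullet> w"
    using R by (auto simp: orthogonal_transformation_def)
  have Rw: "R w = (w $ 1) *\<^sub>R R e1 + (w $ 2) *\<^sub>R R e2" for w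
  proof -
    have "w = (w $ 1) *\<^sub>R e1 + (w $ 2) *\<^sub>R e2"
      by (simp add: vec_eq_iff forall_2 e1_def e2_def axis_def)
    then have "R w = R ((w $ 1) *\<^sub>R e1 + (w $ 2) *\<^sub>R e2)" by (rule arg_cong)
    then show ?thesis by (simp add: linear_add[OF lin] linear_scale[OF lin])
  qed
  define a b c d where "a = R e1 $ 1" and "b = R e1 $ 2" and "c = R e2 $ 1" and "d = R e2 $ 2"
  have n1: "a * a + b * b = 1" and n2: "c * c + d * d = 1" and n3: "a * c + b * d = 0"
    using ip[of e1 e1] ip[of e2 e2] ip[of e1 e2]
    by (simp_all add: inner_2 a_def b_def c_def d_def e1_def e2_def axis_def)
  define \<sigma> where "\<sigma> = a * d - b * c"
  \<comment> \<open>Lagrange's identity for the two columns.\<close>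
  have "(a*a + b*b) * (c*c + d*d) = \<sigma>\<^sup>2 + (a*c + b*d)\<^sup>2"
    unfolding \<sigma>_def by (simp add: power2_eq_square algebra_simps)
  then have s: "\<sigma>\<^sup>2 = 1" using n1 n2 n3 by simp
  have ids: "\<sigma> * c = - b" "\<sigma> * d = a" "\<sigma> * a = d" "\<sigma> * b = - c"
    unfolding \<sigma>_def using n1 n2 n3 by algebra+
  have comp: "R z $ 1 = z $ 1 * a + z $ 2 * c" "R z $ 2 = z $ 1 * b + z $ 2 * d" for z
    by (subst Rw, simp add: a_def b_def c_def d_def)+
  have "(J *v R w) $ 1 = (\<sigma> *\<^sub>R R (J *v w)) $ 1" "(J *v R w) $ 2 = (\<sigma> *\<^sub>R R (J *v w)) $ 2" for w
    using ids by (simp_all add: comp) algebra+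
  then have "J *v R w = \<sigma> *\<^sub>R R (J *v w)" for w by (simp add: vec_eq_iff forall_2)
  with s that show ?thesis by blast
qed

section \<open>The potential near a well\<close>

lemma gradient_eqI: "GDERIV f x :> D \<Longrightarrow> gradient f x = D"
proof -
  assume D: "GDERIV f x :> D"
  have "D' = D" if "GDERIV f x :> D'" for D'
  proof -
    have "(\<lambda>h. h \<bullet> D') = (\<lambda>h. h \<bullet> D)"
      using has_derivative_unique that D unfolding gderiv_def by blast
    then have "(D' - D) \<bullet> D' = (D' - D) \<bullet> D" by metis
    then show ?thesis by (metis eq_iff_diff_eq_0 inner_diff_right inner_eq_zero_iff)
  qed
  with D show ?thesis unfolding gradient_def by (intro the_equality)
qed

text \<open>
  Integrating \<open>g\<close> along rays makes \<open>G\<close> quartic, so on a small ball the quadratic part of \<open>W\<close>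
  absorbs it; this is the last inequality. On a ball of radius at most \<open>1\<close> every exponent
  \<open>q \<ge> 3\<close> may be replaced by \<open>3\<close>.
\<close>

lemma quadratic_well_normal_form:
  fixes W :: "real^2 \<Rightarrow> real"
  assumes well: "quadratic_well W P \<rho> l1 l2 C q"
    and "W P = 0" "\<rho> > 0" "l1 > 0" "l2 > 0" "q \<ge> 3"
  obtains R g :: "real^2 \<Rightarrow> real^2" and r c M :: real where
    "orthogonal_transformation R" "r > 0" "c > 0" "M \<ge> 0"
    "\<And>p. p \<in> ball 0 r \<Longrightarrow>
       gradient W (P + R p) = R (vector [2 * l1\<^sup>2 * p $ 1, 2 * l2\<^sup>2 * p $ 2] + g p)"
    "\<And>p. p \<in> ball 0 r \<Longrightarrow> norm (g p) \<le> M * norm p ^ 3"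
    "\<And>p. p \<in> ball 0 r \<Longrightarrow> c * (norm p)\<^sup>2 \<le> W (P + R p)"
proof -
  obtain R g :: "real^2 \<Rightarrow> real^2" and G :: "real^2 \<Rightarrow> real"
    where R: "orthogonal_transformation R"
    and W: "\<And>p. p \<in> ball 0 \<rho> \<Longrightarrow> W (P + R p) = l1\<^sup>2 * (p $ 1)\<^sup>2 + l2\<^sup>2 * (p $ 2)\<^sup>2 + G p"
    and G: "\<And>p. p \<in> ball 0 \<rho> \<Longrightarrow> GDERIV G p :> g p"
    and g: "\<And>p. p \<in> ball 0 \<rho> \<Longrightarrow> norm (g p) \<le> C * norm p powr q"
    using well unfolding quadratic_well_def by blast
  define m where "m = min (l1\<^sup>2) (l2\<^sup>2)"
  define M where "M = \<bar>C\<bar>"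
  \<comment> \<open>The last bound on the radius makes the quartic \<open>M * norm p ^ 4\<close> at most half of the quadratic part.\<close>
  define r where "r = min \<rho> (min 1 (m / (2 * (M + 1))))"
  have m: "m > 0" using assms by (simp add: m_def)
  have M: "M \<ge> 0" by (simp add: M_def)
  have r: "r > 0" "r \<le> \<rho>" "r \<le> 1" "r \<le> m / (2 * (M + 1))"
    using m M assms by (auto simp: r_def)
  have gM: "norm (g p) \<le> M * norm p ^ 3" if "p \<in> ball 0 r" for p :: "real^2"
  proof -
    have p: "norm p \<le> 1" "p \<in> ball 0 \<rho>" using that r by auto
    have "norm p powr q \<le> norm p powr 3"
      using p \<open>q \<ge> 3\<close> by (intro powr_mono') auto
    also have "\<dots> = norm p ^ 3" by (cases "p = 0") (simp_all add: powr_numeral)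
    finally have "C * norm p powr q \<le> M * norm p ^ 3"
      unfolding M_def by (intro mult_mono) auto
    with g[OF p(2)] show ?thesis by linarith
  qed
  have lin: "linear R" and ip: "\<And>v w. R v \<bullet> R w = v \<bullet> w"
    using R by (auto simp: orthogonal_transformation_def)
  define S where "S = inv R"
  have S: "orthogonal_transformation S"
    unfolding S_def using R by (rule orthogonal_transformation_inv)
  have RS: "R (S z) = z" and SR: "S (R z) = z" for z
    using orthogonal_transformation_bij[OF R] by (simp_all add: S_def bij_is_inj bij_is_surj surj_f_inv_f)
  have blS: "bounded_linear S"
    using orthogonal_transformation_linear[OF S] by (simp add: linear_conv_bounded_linear)
  have G0: "G 0 = 0"
    using W[of 0] \<open>W P = 0\<close> \<open>\<rho> > 0\<close> lin by (simp add: linear_0)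
  have grad: "gradient W (P + R p) = R (vector [2 * l1\<^sup>2 * p $ 1, 2 * l2\<^sup>2 * p $ 2] + g p)"
    if p: "p \<in> ball 0 r" for p :: "real^2"
  proof (rule gradient_eqI)
    let ?F = "\<lambda>p. l1\<^sup>2 * (p $ 1)\<^sup>2 + l2\<^sup>2 * (p $ 2)\<^sup>2 + G p"
    let ?D = "vector [2 * l1\<^sup>2 * p $ 1, 2 * l2\<^sup>2 * p $ 2] + g p"
    have p': "p \<in> ball 0 \<rho>" using p r by auto
    have dF: "(?F has_derivative (\<lambda>h. h \<bullet> ?D)) (at (S (P + R p - P)))"
      using G[OF p'] unfolding gderiv_def
      by (auto intro!: derivative_eq_intros bounded_linear.has_derivative[OF bounded_linear_vec_nth]
            simp: SR inner_2 algebra_simps)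
    have dS: "((\<lambda>z. S (z - P)) has_derivative S) (at (P + R p))"
      by (auto intro!: derivative_eq_intros bounded_linear.has_derivative[OF blS])
    have "((\<lambda>z. ?F (S (z - P))) has_derivative (\<lambda>h. S h \<bullet> ?D)) (at (P + R p))"
      using diff_chain_at[OF dS dF] by (simp add: o_def)
    moreover have "S h \<bullet> ?D = h \<bullet> R ?D" for h using ip[of "S h" ?D] by (simp add: RS)
    ultimately have d: "((\<lambda>z. ?F (S (z - P))) has_derivative (\<lambda>h. h \<bullet> R ?D)) (at (P + R p))" by simp
    have eq: "?F (S (z - P)) = W z" if "z \<in> ball P \<rho>" for z
      using W[of "S (z - P)"] that orthogonal_transformation_norm[OF S, of "z - P"]
      by (simp add: RS dist_norm norm_minus_commute)
    have "P + R p \<in> ball P \<rho>"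
      using p' orthogonal_transformation_norm[OF R, of p] by (simp add: dist_norm)
    then show "GDERIV W (P + R p) :> R ?D"
      unfolding gderiv_def
      by (rule has_derivative_transform_within_open[OF d open_ball]) (rule eq)
  qed
  have low: "m / 2 * (norm p)\<^sup>2 \<le> W (P + R p)" if p: "p \<in> ball 0 r" for p :: "real^2"
  proof -
    have "norm (G p - G 0) \<le> M * norm p ^ 3 * norm (p - 0)"
    proof (rule differentiable_bound[of "cball 0 (norm p)" G "\<lambda>x h. h \<bullet> g x"])
      fix x :: "real^2" assume x: "x \<in> cball 0 (norm p)"
      then have xr: "x \<in> ball 0 r" "x \<in> ball 0 \<rho>" using p r by auto
      show "(G has_derivative (\<lambda>h. h \<bullet> g x)) (at x within cball 0 (norm p))"
        using G[OF xr(2)] unfolding gderiv_def by (rule has_derivative_at_withinI)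
      have "norm (g x) \<le> M * norm x ^ 3" using gM xr by blast
      also have "\<dots> \<le> M * norm p ^ 3"
        using x M by (intro mult_left_mono power_mono) auto
      finally have gx: "norm (g x) \<le> M * norm p ^ 3" .
      show "onorm (\<lambda>h. h \<bullet> g x) \<le> M * norm p ^ 3"
      proof (rule onorm_bound)
        show "0 \<le> M * norm p ^ 3" using M by simp
        fix h
        have "norm (h \<bullet> g x) \<le> norm h * norm (g x)" by (simp add: Cauchy_Schwarz_ineq2)
        also have "\<dots> \<le> norm h * (M * norm p ^ 3)" using gx by (intro mult_left_mono) auto
        finally show "norm (h \<bullet> g x) \<le> M * norm p ^ 3 * norm h" by (simp add: mult.commute)
      qed
    qed auto
    then have "\<bar>G p\<bar> \<le> (M * (norm p)\<^sup>2) * (norm p)\<^sup>2"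
      by (simp add: G0 power2_eq_square power3_eq_cube mult.assoc)
    also have "\<dots> \<le> m / 2 * (norm p)\<^sup>2"
    proof (rule mult_right_mono)
      have "norm p * norm p \<le> norm p * 1" using p r by (intro mult_left_mono) auto
      then have "(norm p)\<^sup>2 \<le> m / (2 * (M + 1))"
        using p r(4) by (simp add: power2_eq_square)
      then have "M * (norm p)\<^sup>2 \<le> M * (m / (2 * (M + 1)))"
        using M by (rule mult_left_mono)
      also have "\<dots> \<le> m / 2" using m M by (simp add: field_simps)
      finally show "M * (norm p)\<^sup>2 \<le> m / 2" .
    qed simp
    finally have Gp: "\<bar>G p\<bar> \<le> m / 2 * (norm p)\<^sup>2" .
    have "m * (norm p)\<^sup>2 \<le> l1\<^sup>2 * (p $ 1)\<^sup>2 + l2\<^sup>2 * (p $ 2)\<^sup>2"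
      unfolding norm_sq_2 distrib_left m_def by (intro add_mono mult_right_mono) auto
    moreover have "W (P + R p) = l1\<^sup>2 * (p $ 1)\<^sup>2 + l2\<^sup>2 * (p $ 2)\<^sup>2 + G p"
      using W p r by auto
    ultimately show ?thesis using Gp by linarith
  qed
  show ?thesis
    by (rule that[OF R r(1) _ M grad gM low]) (use m in auto)
qed

section \<open>The conserved quadratic form of the linearized equation\<close>

text \<open>
  The linear equation \<open>u'' = a * u - \<nu> * v'\<close>, \<open>v'' = b * v + \<nu> * u'\<close> conserves the indefinite energy
  \<open>e(p) = u'\<^sup>2 + v'\<^sup>2 - a * u\<^sup>2 - b * v\<^sup>2\<close>. Its coefficients are constant, so \<open>p'\<close> is again a solution
  and \<open>e(p')\<close> is conserved as well. The form below is \<open>e(p') - k * e(p)\<close>, with the second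
  derivatives eliminated by means of the equation and with \<open>w\<close> in the role of \<open>p'\<close>. When the
  roots \<open>\<mu>\<^sup>2\<close> of the characteristic equation are negative and distinct, such a combination is
  positive definite for every \<open>- k\<close> strictly between them. The choice \<open>k = 2 * l1 * l2 = sqrt (a * b)\<close>
  is the geometric mean of their absolute values and therefore qualifies.
\<close>

definition normal_mode_form :: "real \<Rightarrow> real \<Rightarrow> real \<Rightarrow> real^2 \<Rightarrow> real^2 \<Rightarrow> real" where
  "normal_mode_form l1 l2 \<nu> p w =
     (let a = 2 * l1\<^sup>2; b = 2 * l2\<^sup>2; k = 2 * l1 * l2 in
        a * (a + k) * (p $ 1)\<^sup>2 - 2 * a * \<nu> * p $ 1 * w $ 2 + (\<nu>\<^sup>2 - b - k) * (w $ 2)\<^sup>2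
      + b * (b + k) * (p $ 2)\<^sup>2 + 2 * b * \<nu> * p $ 2 * w $ 1 + (\<nu>\<^sup>2 - a - k) * (w $ 1)\<^sup>2)"

text \<open>
  The constant is the determinant over the trace, which never exceeds the smaller eigenvalue. The
  difference of the two sides, multiplied by the trace, is the square of the length of the
  image of \<open>(x, y)\<close> under the matrix of the form.
\<close>

lemma binary_form_lower_bound:
  fixes A B D :: real
  assumes "A > 0" "A * D > B\<^sup>2"
  obtains m where "m > 0" "\<And>x y. m * (x\<^sup>2 + y\<^sup>2) \<le> A * x\<^sup>2 + 2 * B * x * y + D * y\<^sup>2"
proof
  have D: "D > 0" using assms by (smt (verit) zero_le_power2 zero_less_mult_pos)
  show "(A * D - B\<^sup>2) / (A + D) > 0" using assms D by simp
  fix x y :: real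
  have "(A + D) * (A * x\<^sup>2 + 2 * B * x * y + D * y\<^sup>2) - (A * D - B\<^sup>2) * (x\<^sup>2 + y\<^sup>2)
      = (A * x + B * y)\<^sup>2 + (B * x + D * y)\<^sup>2"
    by (simp add: power2_eq_square algebra_simps)
  then have "(A * D - B\<^sup>2) * (x\<^sup>2 + y\<^sup>2) \<le> (A + D) * (A * x\<^sup>2 + 2 * B * x * y + D * y\<^sup>2)"
    by (smt (verit) zero_le_power2)
  then show "(A * D - B\<^sup>2) / (A + D) * (x\<^sup>2 + y\<^sup>2) \<le> A * x\<^sup>2 + 2 * B * x * y + D * y\<^sup>2"
    using assms D by (simp add: field_simps)
qed

text \<open>
  The form splits into a binary form in \<open>(u, w\<^sub>2)\<close> and one in \<open>(v, w\<^sub>1)\<close>. Their determinants are \<open>a\<close>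
  and \<open>b\<close> times the same number \<open>k * (\<nu>\<^sup>2 - a - b - 2 * k)\<close>, and \<open>a + b + 2 * k = 2 * (l1 + l2)\<^sup>2\<close>:
  this is where the threshold on the speed comes from.
\<close>

lemma normal_mode_form_coercive:
  assumes l: "l1 > 0" "l2 > 0" and \<nu>: "\<nu>\<^sup>2 > 2 * (l1 + l2)\<^sup>2"
  obtains m where "m > 0"
    "\<And>p w. m * ((norm p)\<^sup>2 + (norm w)\<^sup>2) \<le> normal_mode_form l1 l2 \<nu> p w"
proof -
  define a b k where "a = 2 * l1\<^sup>2" and "b = 2 * l2\<^sup>2" and "k = 2 * l1 * l2"
  have pos: "a > 0" "b > 0" "k > 0" using l by (simp_all add: a_def b_def k_def)
  have k2: "k * k = a * b" by (simp add: a_def b_def k_def power2_eq_square)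
  have gap: "\<nu>\<^sup>2 - a - b - 2 * k > 0"
    using \<nu> by (simp add: a_def b_def k_def power2_eq_square algebra_simps)
  have det: "(a + k) * (\<nu>\<^sup>2 - b - k) - a * \<nu>\<^sup>2 = k * (\<nu>\<^sup>2 - a - b - 2 * k)"
            "(b + k) * (\<nu>\<^sup>2 - a - k) - b * \<nu>\<^sup>2 = k * (\<nu>\<^sup>2 - a - b - 2 * k)"
    using k2 by algebra+
  have d: "(a + k) * (\<nu>\<^sup>2 - b - k) > a * \<nu>\<^sup>2" "(b + k) * (\<nu>\<^sup>2 - a - k) > b * \<nu>\<^sup>2"
    using det mult_pos_pos[OF pos(3) gap] by linarith+
  have d1: "(a * (a + k)) * (\<nu>\<^sup>2 - b - k) > (- a * \<nu>)\<^sup>2"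
    using mult_strict_left_mono[OF d(1) pos(1)] by (simp add: power2_eq_square mult_ac)
  have d2: "(b * (b + k)) * (\<nu>\<^sup>2 - a - k) > (b * \<nu>)\<^sup>2"
    using mult_strict_left_mono[OF d(2) pos(2)] by (simp add: power2_eq_square mult_ac)
  obtain m1 where m1: "m1 > 0" "\<And>x y. m1 * (x\<^sup>2 + y\<^sup>2) \<le>
      a * (a + k) * x\<^sup>2 + 2 * (- a * \<nu>) * x * y + (\<nu>\<^sup>2 - b - k) * y\<^sup>2"
    using binary_form_lower_bound[OF _ d1] pos by auto
  obtain m2 where m2: "m2 > 0" "\<And>x y. m2 * (x\<^sup>2 + y\<^sup>2) \<le>
      b * (b + k) * x\<^sup>2 + 2 * (b * \<nu>) * x * y + (\<nu>\<^sup>2 - a - k) * y\<^sup>2"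
    using binary_form_lower_bound[OF _ d2] pos by auto
  show ?thesis
  proof
    show "min m1 m2 > 0" using m1 m2 by simp
    fix p w :: "real^2"
    have "min m1 m2 * ((norm p)\<^sup>2 + (norm w)\<^sup>2)
        = min m1 m2 * ((p $ 1)\<^sup>2 + (w $ 2)\<^sup>2) + min m1 m2 * ((p $ 2)\<^sup>2 + (w $ 1)\<^sup>2)"
      by (simp add: norm_sq_2 algebra_simps)
    also have "\<dots> \<le> m1 * ((p $ 1)\<^sup>2 + (w $ 2)\<^sup>2) + m2 * ((p $ 2)\<^sup>2 + (w $ 1)\<^sup>2)"
      by (intro add_mono mult_right_mono) auto
    also have "\<dots> \<le> normal_mode_form l1 l2 \<nu> p w"
      using m1(2)[of "p $ 1" "w $ 2"] m2(2)[of "p $ 2" "w $ 1"]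
      unfolding normal_mode_form_def Let_def a_def[symmetric] b_def[symmetric] k_def[symmetric]
      by (simp add: algebra_simps)
    finally show "min m1 m2 * ((norm p)\<^sup>2 + (norm w)\<^sup>2) \<le> normal_mode_form l1 l2 \<nu> p w" .
  qed
qed

lemma normal_mode_form_bounded:
  obtains L where "L > 0"
    "\<And>p w. normal_mode_form l1 l2 \<nu> p w \<le> L * ((norm p)\<^sup>2 + (norm w)\<^sup>2)"
proof
  define a b k where "a = 2 * l1\<^sup>2" and "b = 2 * l2\<^sup>2" and "k = 2 * l1 * l2"
  define L where "L = 1 + \<bar>a * (a + k)\<bar> + \<bar>b * (b + k)\<bar> + \<bar>a * \<nu>\<bar> + \<bar>b * \<nu>\<bar> + \<bar>\<nu>\<^sup>2 - b - k\<bar> + \<bar>\<nu>\<^sup>2 - a - k\<bar>"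
  show "L > 0" by (simp add: L_def)
  fix p w :: "real^2"
  have sq: "c * x\<^sup>2 \<le> \<bar>c\<bar> * n" if "x\<^sup>2 \<le> n" for c x n :: real
    using that by (intro mult_mono) auto
  have cross: "2 * c * x * y \<le> \<bar>c\<bar> * n" if "x\<^sup>2 + y\<^sup>2 \<le> n" for c x y n :: real
  proof -
    have "\<bar>x * y\<bar> * 2 \<le> n"
      using sum_squares_bound[of "\<bar>x\<bar>" "\<bar>y\<bar>"] that by (simp add: abs_mult)
    then have "\<bar>c\<bar> * (\<bar>x * y\<bar> * 2) \<le> \<bar>c\<bar> * n" by (rule mult_left_mono) simp
    moreover have "2 * c * x * y \<le> \<bar>2 * c * x * y\<bar>" by simp
    ultimately show ?thesis by (simp add: abs_mult mult_ac)
  qed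
  let ?n = "(norm p)\<^sup>2 + (norm w)\<^sup>2"
  have n: "(p $ 1)\<^sup>2 \<le> ?n" "(p $ 2)\<^sup>2 \<le> ?n" "(w $ 1)\<^sup>2 \<le> ?n" "(w $ 2)\<^sup>2 \<le> ?n"
          "(p $ 1)\<^sup>2 + (w $ 2)\<^sup>2 \<le> ?n" "(p $ 2)\<^sup>2 + (w $ 1)\<^sup>2 \<le> ?n"
    by (simp_all add: norm_sq_2)
  have "normal_mode_form l1 l2 \<nu> p w \<le>
      \<bar>a * (a + k)\<bar> * ?n + \<bar>a * \<nu>\<bar> * ?n + \<bar>\<nu>\<^sup>2 - b - k\<bar> * ?n
    + \<bar>b * (b + k)\<bar> * ?n + \<bar>b * \<nu>\<bar> * ?n + \<bar>\<nu>\<^sup>2 - a - k\<bar> * ?n"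
  proof -
    have "normal_mode_form l1 l2 \<nu> p w =
        a * (a + k) * (p $ 1)\<^sup>2 + 2 * (- a * \<nu>) * p $ 1 * w $ 2 + (\<nu>\<^sup>2 - b - k) * (w $ 2)\<^sup>2
      + b * (b + k) * (p $ 2)\<^sup>2 + 2 * (b * \<nu>) * p $ 2 * w $ 1 + (\<nu>\<^sup>2 - a - k) * (w $ 1)\<^sup>2"
      unfolding normal_mode_form_def Let_def a_def[symmetric] b_def[symmetric] k_def[symmetric]
      by (simp add: algebra_simps)
    also have "\<dots> \<le> \<bar>a * (a + k)\<bar> * ?n + \<bar>- a * \<nu>\<bar> * ?n + \<bar>\<nu>\<^sup>2 - b - k\<bar> * ?n
    + \<bar>b * (b + k)\<bar> * ?n + \<bar>b * \<nu>\<bar> * ?n + \<bar>\<nu>\<^sup>2 - a - k\<bar> * ?n"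
      by (intro add_mono sq cross n)
    finally show ?thesis by simp
  qed
  also have "\<dots> \<le> L * ?n" by (simp add: L_def algebra_simps)
  finally show "normal_mode_form l1 l2 \<nu> p w \<le> L * ?n" .
qed


section \<open>Evolution of the form along a wave\<close>

lemma heteroclinic_waveD:
  assumes "heteroclinic_wave W \<nu> P P' U"
  shows "(U has_vector_derivative vector_derivative U (at x)) (at x)"
    and "((\<lambda>x. vector_derivative U (at x)) has_vector_derivative
          (gradient W (U x) - \<nu> *\<^sub>R (J *v vector_derivative U (at x)))) (at x)"
    and "(U \<longlongrightarrow> P) at_top" and "(U \<longlongrightarrow> P') at_bot"
proof -
  let ?U' = "\<lambda>x. vector_derivative U (at x)"
  have d: "U differentiable (at x)" "?U' differentiable (at x)"
    and eq: "(- \<nu>) *\<^sub>R (J *v ?U' x) = vector_derivative ?U' (at x) - gradient W (U x)"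
    and "(U \<longlongrightarrow> P) at_top" "(U \<longlongrightarrow> P') at_bot"
    using assms unfolding heteroclinic_wave_def Let_def by blast+
  then show "(U \<longlongrightarrow> P) at_top" "(U \<longlongrightarrow> P') at_bot" by blast+
  show "(U has_vector_derivative ?U' x) (at x)"
    using d(1) by (simp add: vector_derivative_works)
  have "vector_derivative ?U' (at x) = gradient W (U x) - \<nu> *\<^sub>R (J *v ?U' x)"
    using eq by (simp add: algebra_simps)
  then show "(?U' has_vector_derivative (gradient W (U x) - \<nu> *\<^sub>R (J *v ?U' x))) (at x)"
    using d(2) by (metis vector_derivative_works)
qed

text \<open>
  Since the linear part conserves the form, the derivative contains only products of the remainder
  \<open>h\<close> with the solution.
\<close>

lemma normal_mode_form_has_derivative:
  fixes p w :: "real \<Rightarrow> real^2" and \<nu> l1 l2 :: real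
  assumes p: "(p has_vector_derivative w x) (at x)"
    and w: "(w has_vector_derivative
      (vector [2 * l1\<^sup>2 * p x $ 1, 2 * l2\<^sup>2 * p x $ 2] + h - \<nu> *\<^sub>R (J *v w x))) (at x)"
  shows "((\<lambda>x. normal_mode_form l1 l2 \<nu> (p x) (w x)) has_real_derivative
      h $ 1 * (4 * l2\<^sup>2 * \<nu> * p x $ 2 + 2 * (\<nu>\<^sup>2 - 2 * l1\<^sup>2 - 2 * l1 * l2) * w x $ 1)
    + h $ 2 * (2 * (\<nu>\<^sup>2 - 2 * l2\<^sup>2 - 2 * l1 * l2) * w x $ 2 - 4 * l1\<^sup>2 * \<nu> * p x $ 1)) (at x)"
proof -
  have comp: "((\<lambda>x. f x $ i) has_real_derivative D $ i) (at x)"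
    if "(f has_vector_derivative D) (at x)" for f :: "real \<Rightarrow> real^2" and D i
    using bounded_linear.has_vector_derivative[OF bounded_linear_vec_nth that]
    by (simp add: has_real_derivative_iff_has_vector_derivative)
  have w1: "((\<lambda>x. w x $ 1) has_real_derivative 2 * l1\<^sup>2 * p x $ 1 + h $ 1 - \<nu> * w x $ 2) (at x)"
    and w2: "((\<lambda>x. w x $ 2) has_real_derivative 2 * l2\<^sup>2 * p x $ 2 + h $ 2 + \<nu> * w x $ 1) (at x)"
    using comp[OF w, of 1] comp[OF w, of 2] by simp_all
  note ders = comp[OF p, of 1] comp[OF p, of 2] w1 w2
  show ?thesis
    unfolding normal_mode_form_def Let_def
    by (rule derivative_eq_intros ders refl)+ (simp add: power2_eq_square, algebra)
qed

lemma normal_mode_form_derivative_bound: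
  fixes l1 l2 \<nu> :: real
  obtains N where "N > 0"
   "\<And>(h :: real^2) (p :: real^2) (w :: real^2).
    \<bar>h $ 1 * (4 * l2\<^sup>2 * \<nu> * p $ 2 + 2 * (\<nu>\<^sup>2 - 2 * l1\<^sup>2 - 2 * l1 * l2) * w $ 1)
    + h $ 2 * (2 * (\<nu>\<^sup>2 - 2 * l2\<^sup>2 - 2 * l1 * l2) * w $ 2 - 4 * l1\<^sup>2 * \<nu> * p $ 1)\<bar>
     \<le> N * norm h * (norm p + norm w)"
proof
  define A B C D where "A = 4 * l2\<^sup>2 * \<nu>" and "B = 2 * (\<nu>\<^sup>2 - 2 * l1\<^sup>2 - 2 * l1 * l2)"
    and "C = 2 * (\<nu>\<^sup>2 - 2 * l2\<^sup>2 - 2 * l1 * l2)" and "D = 4 * l1\<^sup>2 * \<nu>"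
  define N where "N = 1 + \<bar>A\<bar> + \<bar>B\<bar> + \<bar>C\<bar> + \<bar>D\<bar>"
  show "N > 0" by (simp add: N_def)
  fix h p w :: "real^2"
  have le: "\<bar>a * x + b * y\<bar> \<le> \<bar>a\<bar> * X + \<bar>b\<bar> * Y"
    if "\<bar>x\<bar> \<le> X" "\<bar>y\<bar> \<le> Y" for a b x y X Y :: real
    using that by (intro order_trans[OF abs_triangle_ineq] add_mono) (auto simp: abs_mult intro: mult_left_mono)
  have "\<bar>A * p $ 2 + B * w $ 1\<bar> \<le> \<bar>A\<bar> * norm p + \<bar>B\<bar> * norm w"
    "\<bar>C * w $ 2 + (- D) * p $ 1\<bar> \<le> \<bar>C\<bar> * norm w + \<bar>- D\<bar> * norm p"
    by (intro le component_le_norm_cart)+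
  then have "\<bar>h $ 1 * (A * p $ 2 + B * w $ 1) + h $ 2 * (C * w $ 2 + (- D) * p $ 1)\<bar>
      \<le> norm h * (\<bar>A\<bar> * norm p + \<bar>B\<bar> * norm w) + norm h * (\<bar>C\<bar> * norm w + \<bar>- D\<bar> * norm p)"
    by (intro order_trans[OF abs_triangle_ineq] add_mono)
       (auto simp: abs_mult intro!: mult_mono component_le_norm_cart)
  also have "\<dots> \<le> N * norm h * (norm p + norm w)"
    by (simp add: N_def algebra_simps)
  finally show "\<bar>h $ 1 * (4 * l2\<^sup>2 * \<nu> * p $ 2 + 2 * (\<nu>\<^sup>2 - 2 * l1\<^sup>2 - 2 * l1 * l2) * w $ 1)
    + h $ 2 * (2 * (\<nu>\<^sup>2 - 2 * l2\<^sup>2 - 2 * l1 * l2) * w $ 2 - 4 * l1\<^sup>2 * \<nu> * p $ 1)\<bar>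
     \<le> N * norm h * (norm p + norm w)"
    by (simp add: A_def B_def C_def D_def)
qed

text \<open>
  Everything that the nonexistence proof needs from the coordinates at the well, stated without
  them. The remainder is cubic in \<open>p\<close>, so \<open>\<bar>E'\<bar>\<close> is at most a constant times
  \<open>norm p ^ 3 * (norm p + norm w)\<close>. One factor \<open>norm p\<close> joins the last factor to form a
  quantity bounded by \<open>E\<close>, and \<open>norm p\<^sup>2\<close> remains: it is this factor that finite energy makes
  integrable.
\<close>

lemma almost_conserved_quantity:
  assumes wave: "heteroclinic_wave W \<nu> P P' U"
    and well: "quadratic_well W P \<rho> l1 l2 C q" "W P = 0" "\<rho> > 0" "l1 > 0" "l2 > 0" "q \<ge> 3"
    and \<nu>: "\<nu>\<^sup>2 > 2 * (l1 + l2)\<^sup>2"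
  obtains E E' r c K where "r > 0" "c > 0" "K \<ge> 0"
    "\<And>x. E x \<ge> 0"
    "\<And>x. E x = 0 \<longleftrightarrow> U x = P \<and> vector_derivative U (at x) = 0"
    "\<And>x. U x \<in> ball P r \<Longrightarrow> (E has_real_derivative E' x) (at x)"
    "\<And>x. U x \<in> ball P r \<Longrightarrow> \<bar>E' x\<bar> \<le> K * (dist (U x) P)\<^sup>2 * E x"
    "\<And>x. U x \<in> ball P r \<Longrightarrow> c * (dist (U x) P)\<^sup>2 \<le> W (U x)"
    "\<And>x. U x \<in> ball P r \<Longrightarrow>
       c * E x \<le> 1 / 2 * (norm (vector_derivative U (at x)))\<^sup>2 + W (U x)"
proof -
  obtain R g :: "real^2 \<Rightarrow> real^2" and r c M :: real where R: "orthogonal_transformation R"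
    and r: "r > 0" and c: "c > 0" and M: "M \<ge> 0"
    and grad: "\<And>p. p \<in> ball 0 r \<Longrightarrow>
       gradient W (P + R p) = R (vector [2 * l1\<^sup>2 * p $ 1, 2 * l2\<^sup>2 * p $ 2] + g p)"
    and g: "\<And>p. p \<in> ball 0 r \<Longrightarrow> norm (g p) \<le> M * norm p ^ 3"
    and W: "\<And>p. p \<in> ball 0 r \<Longrightarrow> c * (norm p)\<^sup>2 \<le> W (P + R p)"
    using quadratic_well_normal_form[OF well] by metis
  obtain \<sigma> :: real where \<sigma>: "\<sigma>\<^sup>2 = 1" and JR: "\<And>w. J *v R w = \<sigma> *\<^sub>R R (J *v w)"
    using orthogonal_transformation_J[OF R] by metis
  define S where "S = inv R"
  have S: "orthogonal_transformation S"
    unfolding S_def using R by (rule orthogonal_transformation_inv)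
  have RS: "R (S z) = z" and SR: "S (R z) = z" for z
    using orthogonal_transformation_bij[OF R]
    by (simp_all add: S_def bij_is_inj bij_is_surj surj_f_inv_f)
  have linS: "linear S" using S by (rule orthogonal_transformation_linear)
  then have blS: "bounded_linear S" by (simp add: linear_conv_bounded_linear)
  have nS: "norm (S z) = norm z" for z using orthogonal_transformation_norm[OF S] by simp
  define U' where "U' = (\<lambda>x. vector_derivative U (at x))"
  define p w where "p = (\<lambda>x. S (U x - P))" and "w = (\<lambda>x. S (U' x))"
  have np: "norm (p x) = dist (U x) P" and nw: "norm (w x) = norm (U' x)"
    and Up: "U x = P + R (p x)" for x
    by (simp_all add: p_def w_def nS RS dist_norm)
  have pball: "p x \<in> ball 0 r" if "U x \<in> ball P r" for x
    using that np[of x] by (simp add: dist_commute)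
  define h where "h = (\<lambda>x. g (p x))"
  have dp: "(p has_vector_derivative w x) (at x)" for x
  proof -
    have "((\<lambda>x. U x - P) has_vector_derivative U' x) (at x)"
      using heteroclinic_waveD(1)[OF wave, of x] unfolding U'_def
      by (auto intro!: derivative_eq_intros)
    from bounded_linear.has_vector_derivative[OF blS this]
    show ?thesis by (simp add: p_def w_def)
  qed
  have dw: "(w has_vector_derivative (vector [2 * l1\<^sup>2 * p x $ 1, 2 * l2\<^sup>2 * p x $ 2] + h x
      - (\<nu> * \<sigma>) *\<^sub>R (J *v w x))) (at x)" if x: "U x \<in> ball P r" for x
  proof -
    have "S (gradient W (U x) - \<nu> *\<^sub>R (J *v U' x))
        = S (gradient W (U x)) - \<nu> *\<^sub>R S (J *v U' x)"
      by (simp add: linear_diff[OF linS] linear_scale[OF linS])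
    moreover have "S (gradient W (U x)) = vector [2 * l1\<^sup>2 * p x $ 1, 2 * l2\<^sup>2 * p x $ 2] + h x"
      using grad[OF pball[OF x]] by (simp add: SR h_def flip: Up)
    moreover have "S (J *v U' x) = \<sigma> *\<^sub>R (J *v w x)"
      using JR[of "w x"] by (simp add: w_def RS SR linear_scale[OF linS])
    ultimately show ?thesis
      using bounded_linear.has_vector_derivative[OF blS heteroclinic_waveD(2)[OF wave, of x]]
      by (simp add: w_def U'_def)
  qed
  have \<nu>': "(\<nu> * \<sigma>)\<^sup>2 > 2 * (l1 + l2)\<^sup>2" using \<nu> \<sigma> by (simp add: power_mult_distrib)
  define E where "E = (\<lambda>x. normal_mode_form l1 l2 (\<nu> * \<sigma>) (p x) (w x))"
  define E' where "E' = (\<lambda>x.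
      h x $ 1 * (4 * l2\<^sup>2 * (\<nu> * \<sigma>) * p x $ 2
                + 2 * ((\<nu> * \<sigma>)\<^sup>2 - 2 * l1\<^sup>2 - 2 * l1 * l2) * w x $ 1)
    + h x $ 2 * (2 * ((\<nu> * \<sigma>)\<^sup>2 - 2 * l2\<^sup>2 - 2 * l1 * l2) * w x $ 2
                - 4 * l1\<^sup>2 * (\<nu> * \<sigma>) * p x $ 1))"
  obtain m where m: "m > 0" and Em: "\<And>x. m * ((norm (p x))\<^sup>2 + (norm (w x))\<^sup>2) \<le> E x"
    unfolding E_def using normal_mode_form_coercive[OF well(4,5) \<nu>'] by metis
  obtain L where L: "L > 0" and EL: "\<And>x. E x \<le> L * ((norm (p x))\<^sup>2 + (norm (w x))\<^sup>2)"
    unfolding E_def using normal_mode_form_bounded by metis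
  obtain N where N: "N > 0" and E'N: "\<And>x. \<bar>E' x\<bar> \<le> N * norm (h x) * (norm (p x) + norm (w x))"
    unfolding E'_def using normal_mode_form_derivative_bound by metis
  define K where "K = 2 * N * M / m"
  \<comment> \<open>The minimum with \<open>1/2\<close> matches the kinetic part \<open>1/2 * norm w\<^sup>2\<close> of the energy density.\<close>
  define c' where "c' = min c (min (1/2) c / L)"
  show ?thesis
  proof
    show "r > 0" by fact
    show "c' > 0" using c L by (simp add: c'_def)
    show "K \<ge> 0" using N M m by (simp add: K_def)
    fix x
    have sq: "0 \<le> m * ((norm (p x))\<^sup>2 + (norm (w x))\<^sup>2)" using m by simp
    show "E x \<ge> 0" using Em[of x] sq by linarith
    show "E x = 0 \<longleftrightarrow> U x = P \<and> vector_derivative U (at x) = 0"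
    proof
      assume "E x = 0"
      then have "m * ((norm (p x))\<^sup>2 + (norm (w x))\<^sup>2) = 0" using Em[of x] sq by linarith
      then have "norm (p x) = 0" "norm (w x) = 0"
        using m by (simp_all add: add_nonneg_eq_0_iff)
      then show "U x = P \<and> vector_derivative U (at x) = 0"
        unfolding np nw by (simp add: U'_def)
    next
      assume "U x = P \<and> vector_derivative U (at x) = 0"
      then have "norm (p x) = 0" "norm (w x) = 0" unfolding np nw by (simp_all add: U'_def)
      then show "E x = 0" using Em[of x] EL[of x] by simp
    qed
    assume x: "U x \<in> ball P r"
    show "(E has_real_derivative E' x) (at x)"
      unfolding E_def E'_def by (rule normal_mode_form_has_derivative[OF dp dw[OF x]])
    show "\<bar>E' x\<bar> \<le> K * (dist (U x) P)\<^sup>2 * E x"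
    proof -
      let ?a = "norm (p x)" and ?b = "norm (w x)"
      have "\<bar>E' x\<bar> \<le> N * (M * ?a ^ 3) * (?a + ?b)"
        by (rule order_trans[OF E'N]) (use N g[OF pball[OF x]] in \<open>intro mult_right_mono mult_left_mono, auto simp: h_def\<close>)
      also have "\<dots> = N * M * ?a\<^sup>2 * (?a * (?a + ?b))"
        by (simp add: power2_eq_square power3_eq_cube mult_ac)
      also have "\<dots> \<le> N * M * ?a\<^sup>2 * (2 * (?a\<^sup>2 + ?b\<^sup>2))"
      proof (rule mult_left_mono)
        have "2 * ?a * ?b \<le> ?a\<^sup>2 + ?b\<^sup>2" by (rule sum_squares_bound)
        moreover have "0 \<le> ?a\<^sup>2" "0 \<le> ?b\<^sup>2" by simp_all
        moreover have "?a * (?a + ?b) = ?a\<^sup>2 + ?a * ?b" by (simp add: power2_eq_square distrib_left)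
        ultimately show "?a * (?a + ?b) \<le> 2 * (?a\<^sup>2 + ?b\<^sup>2)" by argo
      qed (use N M in simp)
      also have "\<dots> \<le> N * M * ?a\<^sup>2 * (2 * (E x / m))"
        using Em[of x] m N M by (intro mult_left_mono) (auto simp: field_simps)
      also have "\<dots> = K * ?a\<^sup>2 * E x" by (simp add: K_def)
      finally show ?thesis by (simp add: np)
    qed
    have Wx: "c * (norm (p x))\<^sup>2 \<le> W (U x)" using W[OF pball[OF x]] by (simp flip: Up)
    moreover have "c' * (norm (p x))\<^sup>2 \<le> c * (norm (p x))\<^sup>2"
      by (intro mult_right_mono) (auto simp: c'_def)
    ultimately show "c' * (dist (U x) P)\<^sup>2 \<le> W (U x)" by (simp add: np)
    have "c' * E x \<le> min (1/2) c / L * E x"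
      using \<open>E x \<ge> 0\<close> by (intro mult_right_mono) (auto simp: c'_def)
    also have "\<dots> \<le> min (1/2) c / L * (L * ((norm (p x))\<^sup>2 + (norm (w x))\<^sup>2))"
      using EL c L by (intro mult_left_mono) auto
    also have "\<dots> = min (1/2) c * (norm (w x))\<^sup>2 + min (1/2) c * (norm (p x))\<^sup>2"
      using L by (simp add: field_simps)
    also have "\<dots> \<le> 1/2 * (norm (w x))\<^sup>2 + c * (norm (p x))\<^sup>2"
      by (intro add_mono mult_right_mono) auto
    also have "\<dots> \<le> 1/2 * (norm (w x))\<^sup>2 + W (U x)" using Wx by simp
    finally show "c' * E x \<le> 1 / 2 * (norm (vector_derivative U (at x)))\<^sup>2 + W (U x)"
      by (simp add: nw U'_def)
  qed
qed

section \<open>Gronwall estimates\<close>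

text \<open>
  The bound on \<open>E'\<close> says that \<open>E * exp \<Phi>\<close> increases and \<open>E * exp (- \<Phi>)\<close> decreases. Both are treated
  at once as monotonicity of \<open>s * (E * exp (s * \<Phi>))\<close> for \<open>s = 1\<close> and \<open>s = - 1\<close>.
\<close>

lemma gronwall_two_sided:
  fixes E E' \<Phi> \<phi> :: "real \<Rightarrow> real"
  assumes "a \<le> b"
    and E: "\<And>x. x \<in> {a..b} \<Longrightarrow> (E has_real_derivative E' x) (at x)"
    and \<Phi>: "\<And>x. x \<in> {a..b} \<Longrightarrow> (\<Phi> has_real_derivative \<phi> x) (at x within {a..b})"
    and bound: "\<And>x. x \<in> {a..b} \<Longrightarrow> \<bar>E' x\<bar> \<le> \<phi> x * E x"
  shows "E a \<le> E b * exp (\<Phi> b - \<Phi> a)" and "E b \<le> E a * exp (\<Phi> b - \<Phi> a)"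
proof -
  have mono: "s * (E a * exp (s * \<Phi> a)) \<le> s * (E b * exp (s * \<Phi> b))" if s: "s = 1 \<or> s = -1" for s :: real
  proof (rule DERIV_nonneg_imp_increasing_open[OF \<open>a \<le> b\<close>])
    have ders: "((\<lambda>x. s * (E x * exp (s * \<Phi> x))) has_real_derivative
        s * (E' x * exp (s * \<Phi> x) + exp (s * \<Phi> x) * (s * \<phi> x) * E x)) (at x within {a..b})"
      if "x \<in> {a..b}" for x
      by (rule derivative_eq_intros DERIV_subset[OF E[OF that]] \<Phi>[OF that] refl subset_UNIV)+ simp
    show "continuous_on {a..b} (\<lambda>x. s * (E x * exp (s * \<Phi> x)))"
      by (rule DERIV_continuous_on[OF ders])
    fix x assume x: "a < x" "x < b"
    have "0 \<le> exp (s * \<Phi> x) * (s * E' x + \<phi> x * E x)"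
      using bound[of x] s x by (intro mult_nonneg_nonneg) auto
    also have "\<dots> = s * (E' x * exp (s * \<Phi> x) + exp (s * \<Phi> x) * (s * \<phi> x) * E x)"
      using s by (auto simp: algebra_simps)
    finally show "\<exists>y. ((\<lambda>x. s * (E x * exp (s * \<Phi> x))) has_real_derivative y) (at x) \<and> 0 \<le> y"
      using ders[of x] x by (auto simp: at_within_Icc_at)
  qed
  show "E a \<le> E b * exp (\<Phi> b - \<Phi> a)" using mono[of 1] by (simp add: exp_diff field_simps)
  show "E b \<le> E a * exp (\<Phi> b - \<Phi> a)" using mono[of "-1"] by (simp add: exp_diff exp_minus field_simps)
qed


text \<open>
  This is the local uniqueness of the constant solution, expressed through \<open>E\<close>. Near \<open>x\<close> the curve stays in the
  ball, where \<open>\<bar>E'\<bar> \<le> K * r\<^sup>2 * E\<close>, and Gronwall's inequality in both directions propagates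
  the zero.
\<close>

lemma almost_conserved_zero_spreads:
  fixes E E' :: "real \<Rightarrow> real" and U :: "real \<Rightarrow> 'a::real_normed_vector"
  assumes "r > 0" "K \<ge> 0" and U: "continuous_on UNIV U"
    and "U x = P" "E x = 0" and nonneg: "\<And>x. E x \<ge> 0"
    and E: "\<And>x. U x \<in> ball P r \<Longrightarrow> (E has_real_derivative E' x) (at x)"
    and E': "\<And>x. U x \<in> ball P r \<Longrightarrow> \<bar>E' x\<bar> \<le> K * (dist (U x) P)\<^sup>2 * E x"
  obtains d where "d > 0" "\<And>y. y \<in> ball x d \<Longrightarrow> E y = 0"
proof -
  have "open (U -` ball P r)" using U by (simp add: continuous_on_open_vimage)
  moreover have "x \<in> U -` ball P r" using assms by simp
  ultimately obtain d where d: "d > 0" "ball x d \<subseteq> U -` ball P r" by (meson openE)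
  have \<Phi>: "((\<lambda>z. K * r\<^sup>2 * z) has_real_derivative K * r\<^sup>2) (at z within A)" for z A
    by (auto intro!: derivative_eq_intros)
  have bound: "\<bar>E' z\<bar> \<le> K * r\<^sup>2 * E z" if "z \<in> ball x d" for z
  proof -
    have z: "U z \<in> ball P r" using that d by auto
    then have "dist (U z) P \<le> r" by (simp add: dist_commute)
    then have "K * (dist (U z) P)\<^sup>2 * E z \<le> K * r\<^sup>2 * E z"
      using nonneg \<open>K \<ge> 0\<close> by (intro mult_right_mono mult_left_mono power_mono) auto
    with E'[OF z] show ?thesis by linarith
  qed
  have zero: "E y = 0" if y: "y \<in> ball x d" for y
  proof (cases "y \<le> x")
    case True
    have sub: "{y..x} \<subseteq> ball x d" using y by (auto simp: dist_real_def)
    have "E y \<le> E x * exp (K * r\<^sup>2 * x - K * r\<^sup>2 * y)"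
      by (rule gronwall_two_sided(1)[OF True, of E E' "\<lambda>z. K * r\<^sup>2 * z" "\<lambda>z. K * r\<^sup>2"])
         (use sub d E \<Phi> bound in blast)+
    then show ?thesis using \<open>E x = 0\<close> nonneg[of y] by simp
  next
    case False
    then have "x \<le> y" by simp
    have sub: "{x..y} \<subseteq> ball x d" using y by (auto simp: dist_real_def)
    have "E y \<le> E x * exp (K * r\<^sup>2 * y - K * r\<^sup>2 * x)"
      by (rule gronwall_two_sided(2)[OF \<open>x \<le> y\<close>, of E E' "\<lambda>z. K * r\<^sup>2 * z" "\<lambda>z. K * r\<^sup>2"])
         (use sub d E \<Phi> bound in blast)+
    then show ?thesis using \<open>E x = 0\<close> nonneg[of y] by simp
  qed
  show ?thesis by (rule that[OF d(1) zero])
qed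

lemma nonneg_integral_le_nn_integral:
  fixes f :: "real \<Rightarrow> real" and F :: "real \<Rightarrow> ennreal"
  assumes cont: "continuous_on {a..b} f" and nonneg: "\<And>x. x \<in> {a..b} \<Longrightarrow> 0 \<le> f x"
    and le: "\<And>x. x \<in> {a..b} \<Longrightarrow> ennreal (f x) \<le> F x"
  shows "ennreal (integral {a..b} f) \<le> (\<integral>\<^sup>+x. F x \<partial>lborel)"
proof -
  have "ennreal (integral {a..b} f) = (\<integral>\<^sup>+x. ennreal (f x) * indicator {a..b} x \<partial>lborel)"
    using integrable_integral[OF integrable_continuous_interval[OF cont]] nonneg
    by (intro nn_integral_has_integral_lebesgue'[symmetric]) auto
  also have "\<dots> \<le> (\<integral>\<^sup>+x. F x \<partial>lborel)"
    by (intro nn_integral_mono) (use le in \<open>auto simp: indicator_def\<close>)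
  finally show ?thesis .
qed

section \<open>No finite-energy wave ends at a fast well\<close>

text \<open>
  A wave reaching the well with finite energy would have to lose its \<open>E\<close>, but integrability of
  \<open>dist U P\<^sup>2\<close> allows \<open>E\<close> to decrease at most by a fixed factor.
\<close>

lemma no_wave_into_fast_rotating_well:
  fixes W :: "real^2 \<Rightarrow> real"
  assumes wave: "heteroclinic_wave W \<nu> P P' U" and fin: "energy W U < \<infinity>"
    and "P \<noteq> P'"
    and well: "quadratic_well W P \<rho> l1 l2 C q" "W P = 0" "\<rho> > 0" "l1 > 0" "l2 > 0" "q \<ge> 3"
    and \<nu>: "\<nu>\<^sup>2 > 2 * (l1 + l2)\<^sup>2"
  shows False
proof -
  define U' where "U' = (\<lambda>x. vector_derivative U (at x))"
  obtain E E' r c K where r: "r > 0" and c: "c > 0" and K: "K \<ge> 0"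
    and E0: "\<And>x. E x \<ge> 0"
    and Ez: "\<And>x. E x = 0 \<longleftrightarrow> U x = P \<and> U' x = 0"
    and dE: "\<And>x. U x \<in> ball P r \<Longrightarrow> (E has_real_derivative E' x) (at x)"
    and E': "\<And>x. U x \<in> ball P r \<Longrightarrow> \<bar>E' x\<bar> \<le> K * (dist (U x) P)\<^sup>2 * E x"
    and cW: "\<And>x. U x \<in> ball P r \<Longrightarrow> c * (dist (U x) P)\<^sup>2 \<le> W (U x)"
    and cE: "\<And>x. U x \<in> ball P r \<Longrightarrow> c * E x \<le> 1 / 2 * (norm (U' x))\<^sup>2 + W (U x)"
    unfolding U'_def by (rule almost_conserved_quantity[OF wave well \<nu>]) blast
  have contU: "continuous_on UNIV U" and contU': "continuous_on UNIV U'"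
    using heteroclinic_waveD(1,2)[OF wave] unfolding U'_def
    by (auto intro!: continuous_at_imp_continuous_on has_vector_derivative_continuous)
  \<comment> \<open>The zeros of \<open>E\<close> form a set that is both open and closed.\<close>
  have pos: "E x > 0" for x
  proof (rule ccontr)
    assume "\<not> E x > 0"
    define Z where "Z = {x. E x = 0}"
    have "x \<in> Z" using \<open>\<not> E x > 0\<close> E0[of x] by (simp add: Z_def)
    have "Z = (U -` {P}) \<inter> (U' -` {0})" by (auto simp: Z_def Ez)
    then have "closed Z" using contU contU' by (auto simp: continuous_on_closed_vimage)
    moreover have "open Z"
      unfolding open_contains_ball
    proof
      fix y assume "y \<in> Z"
      then have y: "E y = 0" "U y = P" using Ez by (auto simp: Z_def)
      show "\<exists>d>0. ball y d \<subseteq> Z"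
        by (rule almost_conserved_zero_spreads[OF r K contU y(2,1) E0 dE E']) (auto simp: Z_def)
    qed
    ultimately have "Z = UNIV" using \<open>x \<in> Z\<close> clopen by blast
    then have "U = (\<lambda>_. P)" using Ez by (auto simp: Z_def)
    then have "P' = P" using heteroclinic_waveD(4)[OF wave] by (simp add: tendsto_const_iff)
    with \<open>P \<noteq> P'\<close> show False by simp
  qed
  have "eventually (\<lambda>x. U x \<in> ball P r) at_top"
    using tendstoD[OF heteroclinic_waveD(3)[OF wave] r] by (simp add: dist_commute)
  then obtain x0 where x0: "\<And>x. x \<ge> x0 \<Longrightarrow> U x \<in> ball P r"
    by (auto simp: eventually_at_top_linorder)
  obtain I where I: "I \<ge> 0" "energy W U = ennreal I"
    using fin by (cases "energy W U") auto
  let ?f = "\<lambda>x. K * (dist (U x) P)\<^sup>2"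
  have contf: "continuous_on A ?f" for A
    by (intro continuous_intros continuous_on_subset[OF contU]) simp
  have contd: "continuous_on A (\<lambda>x. c * (dist (U x) P)\<^sup>2)" for A
    by (intro continuous_intros continuous_on_subset[OF contU]) simp
  define \<delta> where "\<delta> = E x0 * exp (- (K / c * I))"
  have \<delta>: "\<delta> > 0" using pos by (simp add: \<delta>_def)
  have low: "\<delta> \<le> E x" if x: "x \<ge> x0" for x
  proof -
    have int: "integral {x0..x} ?f \<le> K / c * I"
    proof -
      have "ennreal (integral {x0..x} (\<lambda>x. c * (dist (U x) P)\<^sup>2)) \<le> energy W U"
        unfolding energy_def
      proof (rule nonneg_integral_le_nn_integral[OF contd])
        fix y assume y: "y \<in> {x0..x}"
        show "0 \<le> c * (dist (U y) P)\<^sup>2" using c by simp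
        have "c * (dist (U y) P)\<^sup>2 \<le> 1 / 2 * (norm (vector_derivative U (at y)))\<^sup>2 + W (U y)"
          using cW[OF x0[of y]] y by (simp add: add_increasing)
        then show "ennreal (c * (dist (U y) P)\<^sup>2)
            \<le> ennreal (1 / 2 * (norm (vector_derivative U (at y)))\<^sup>2 + W (U y))"
          by (rule ennreal_leI)
      qed
      then have "c * integral {x0..x} (\<lambda>x. (dist (U x) P)\<^sup>2) \<le> I"
        using I by (simp add: ennreal_le_iff)
      then have "K / c * (c * integral {x0..x} (\<lambda>x. (dist (U x) P)\<^sup>2)) \<le> K / c * I"
        using K c by (intro mult_left_mono) auto
      then show ?thesis using c by simp
    qed
    have "E x0 \<le> E x * exp (integral {x0..x} ?f - integral {x0..x0} ?f)"
    proof (rule gronwall_two_sided(1)[OF x, where E = E and E' = E' and \<phi> = ?f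
            and \<Phi> = "\<lambda>y. integral {x0..y} ?f"])
      fix y assume y: "y \<in> {x0..x}"
      then have Uy: "U y \<in> ball P r" using x0 by simp
      show "(E has_real_derivative E' y) (at y)" by (rule dE[OF Uy])
      show "((\<lambda>y. integral {x0..y} ?f) has_real_derivative ?f y) (at y within {x0..x})"
        by (rule integral_has_real_derivative[OF contf y])
      show "\<bar>E' y\<bar> \<le> ?f y * E y" by (rule E'[OF Uy])
    qed
    also have "\<dots> \<le> E x * exp (K / c * I)"
      using int E0 by (intro mult_left_mono) auto
    finally show ?thesis by (simp add: \<delta>_def exp_minus field_simps)
  qed
  \<comment> \<open>An interval so long that the energy density \<open>c * \<delta>\<close> on it already gives \<open>I + 1\<close>.\<close>
  define n where "n = (I + 1) / (c * \<delta>)"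
  have n: "n \<ge> 0" using I c \<delta> by (simp add: n_def)
  have "ennreal (integral {x0..x0 + n} (\<lambda>x. c * \<delta>)) \<le> energy W U"
    unfolding energy_def
  proof (rule nonneg_integral_le_nn_integral)
    fix y assume y: "y \<in> {x0..x0 + n}"
    then have "c * \<delta> \<le> c * E y" using c low by (intro mult_left_mono) auto
    also have "\<dots> \<le> 1 / 2 * (norm (vector_derivative U (at y)))\<^sup>2 + W (U y)"
      using cE[OF x0[of y]] y by (simp add: U'_def)
    finally show "ennreal (c * \<delta>)
        \<le> ennreal (1 / 2 * (norm (vector_derivative U (at y)))\<^sup>2 + W (U y))"
      by (rule ennreal_leI)
  qed (use c \<delta> in auto)
  then have "n * (c * \<delta>) \<le> I" using I n by (simp add: ennreal_le_iff mult_ac)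
  then show False using c \<delta> by (simp add: n_def)
qed

section \<open>Reflection of the line\<close>

lemma vector_derivative_reflect:
  fixes f :: "real \<Rightarrow> 'a::real_normed_vector"
  assumes "f differentiable (at (- x))"
  shows "((\<lambda>x. f (- x)) has_vector_derivative - vector_derivative f (at (- x))) (at x)"
proof -
  have f: "(f has_vector_derivative vector_derivative f (at (- x))) (at (- x))"
    using assms by (simp add: vector_derivative_works)
  have "(uminus has_vector_derivative (- 1 :: real)) (at x)"
    by (auto intro!: derivative_eq_intros)
  from vector_diff_chain_at[OF this f] show ?thesis by (simp add: o_def)
qed

lemma heteroclinic_wave_reflect:
  assumes wave: "heteroclinic_wave W \<nu> P P' U"
  shows "heteroclinic_wave W (- \<nu>) P' P (\<lambda>x. U (- x))"
proof -
  define U' where "U' = (\<lambda>x. vector_derivative U (at x))"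
  have d: "U differentiable (at x)" "U' differentiable (at x)" 
    and eq: "(- \<nu>) *\<^sub>R (J *v U' x) = vector_derivative U' (at x) - gradient W (U x)"
    and lim: "(U \<longlongrightarrow> P) at_top" "(U \<longlongrightarrow> P') at_bot" for x
    using wave unfolding heteroclinic_wave_def Let_def U'_def by blast+
  have v1: "((\<lambda>x. U (- x)) has_vector_derivative - U' (- x)) (at x)" for x
    unfolding U'_def by (rule vector_derivative_reflect[OF d(1)])
  have v2: "((\<lambda>x. - U' (- x)) has_vector_derivative vector_derivative U' (at (- x))) (at x)" for x
    using has_vector_derivative_minus[OF vector_derivative_reflect[OF d(2)]] by simp
  have e1: "(\<lambda>x. vector_derivative (\<lambda>x. U (- x)) (at x)) = (\<lambda>x. - U' (- x))"
    using v1 by (auto intro!: vector_derivative_at)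
  have e2: "vector_derivative (\<lambda>x. - U' (- x)) (at x) = vector_derivative U' (at (- x))" for x
    using v2 by (auto intro!: vector_derivative_at)
  have Jm: "J *v (- z) = - (J *v z)" for z by (simp add: vec_eq_iff forall_2)
  have "((\<lambda>x. U (- x)) \<longlongrightarrow> P') at_top" "((\<lambda>x. U (- x)) \<longlongrightarrow> P) at_bot"
    using lim filterlim_at_top_mirror[of U "nhds P"] filterlim_at_bot_mirror[of U "nhds P'"] by auto
  moreover have "(\<lambda>x. U (- x)) differentiable (at x)" "(\<lambda>x. - U' (- x)) differentiable (at x)" for x
    using v1 v2 by (blast intro: differentiableI_vector)+
  moreover have "(- (- \<nu>)) *\<^sub>R (J *v (- U' (- x))) = vector_derivative U' (at (- x)) - gradient W (U (- x))" for x
    using eq[of "- x"] by (simp add: Jm)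
  ultimately show ?thesis
    unfolding heteroclinic_wave_def Let_def e1 e2 by blast
qed

lemma energy_reflect:
  assumes wave: "heteroclinic_wave W \<nu> P P' U" and W: "continuous_on UNIV W"
  shows "energy W (\<lambda>x. U (- x)) = energy W U"
proof -
  have contU: "continuous_on UNIV U" and contU': "continuous_on UNIV (\<lambda>x. vector_derivative U (at x))"
    using heteroclinic_waveD(1,2)[OF wave] 
    by (auto intro!: continuous_at_imp_continuous_on has_vector_derivative_continuous)
  let ?h = "\<lambda>y. 1 / 2 * (norm (vector_derivative U (at y)))\<^sup>2 + W (U y)"
  have "continuous_on UNIV ?h"
    by (intro continuous_intros contU' continuous_on_compose2[OF W contU]) auto
  then have m: "(\<lambda>y. ennreal (?h y)) \<in> borel_measurable borel"
    by (intro measurable_compose[OF borel_measurable_continuous_onI measurable_ennreal])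
  have vd: "vector_derivative (\<lambda>x. U (- x)) (at y) = - vector_derivative U (at (- y))" for y
    by (intro vector_derivative_at vector_derivative_reflect
          differentiableI_vector[OF heteroclinic_waveD(1)[OF wave]])
  have "energy W (\<lambda>x. U (- x)) = (\<integral>\<^sup>+ y. ennreal (?h (0 + (- 1) * y)) \<partial>lborel)"
    unfolding energy_def vd by simp
  also have "\<dots> = energy W U"
    using nn_integral_real_affine[OF m, of "- 1" 0] by (simp add: energy_def)
  finally show ?thesis .
qed

lemma Ck_imp_continuous: "Ck k f \<Longrightarrow> continuous_on UNIV f"
  by (cases k) (auto intro!: continuous_at_imp_continuous_on differentiable_imp_continuous_within)

theorem proposition4p12:
  fixes W :: "real^2 \<Rightarrow> real"
    and p_plus p_minus :: "real^2"
    and \<rho>_plus \<rho>_minus l1_plus l2_plus l1_minus l2_minus C q \<nu> :: real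
  assumes "Ck 3 W"
    and "\<And>u. W u \<ge> 0"
    and "p_plus \<noteq> p_minus"
    and "\<And>u. W u = 0 \<longleftrightarrow> u = p_plus \<or> u = p_minus"
    and "\<rho>_plus > 0" and "\<rho>_minus > 0"
    and "l1_plus > 0" and "l2_plus > 0" and "l1_minus > 0" and "l2_minus > 0"
    and "q \<ge> 3"
    and "quadratic_well W p_plus \<rho>_plus l1_plus l2_plus C q"
    and "quadratic_well W p_minus \<rho>_minus l1_minus l2_minus C q"
    and "\<nu>\<^sup>2 > min (2 * (l1_plus + l2_plus)\<^sup>2) (2 * (l1_minus + l2_minus)\<^sup>2)"
  shows "\<not> (\<exists>U. heteroclinic_wave W \<nu> p_plus p_minus U \<and> energy W U < \<infinity>)"
proof
  assume "\<exists>U. heteroclinic_wave W \<nu> p_plus p_minus U \<and> energy W U < \<infinity>"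
  then obtain U where wave: "heteroclinic_wave W \<nu> p_plus p_minus U"
    and fin: "energy W U < \<infinity>" by blast
  have W0: "W p_plus = 0" "W p_minus = 0" using assms(4) by blast+
  consider "\<nu>\<^sup>2 > 2 * (l1_plus + l2_plus)\<^sup>2" | "\<nu>\<^sup>2 > 2 * (l1_minus + l2_minus)\<^sup>2"
    using assms(14) by linarith
  then show False
  proof cases
    case 1
    show False
      by (rule no_wave_into_fast_rotating_well[OF wave fin assms(3,12) W0(1) assms(5,7,8,11) 1])
  next
    case 2
    have "energy W (\<lambda>x. U (- x)) < \<infinity>"
      using energy_reflect[OF wave Ck_imp_continuous[OF assms(1)]] fin by simp
    moreover have "(- \<nu>)\<^sup>2 > 2 * (l1_minus + l2_minus)\<^sup>2" using 2 by simp
    ultimately show False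
      by (rule no_wave_into_fast_rotating_well[OF heteroclinic_wave_reflect[OF wave] _
            assms(3)[symmetric] assms(13) W0(2) assms(6,9,10,11)])
  qed
qed

end
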